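(* Let $\alpha$ be an algebraic number satisfying $0<\alpha\leq 1$. Then there exist random variables $\mathbb{X}_\alpha(n)$, indexed by the integers $n\geq 0$ and defined on a common probability space, which take values in the unit circle $\{z\in\mathbb{C}: |z|=1\}$ and satisfy $$\mathbb{E}\left[\mathbb{X}_\alpha(n_1)^{e_1}\cdots\mathbb{X}_\alpha(n_k)^{e_k}\right]=\begin{cases}1 & \text{if } (n_1+\alpha)^{e_1}\cdots(n_k+\alpha)^{e_k}=1,\\ 0 & \text{otherwise}\end{cases}$$ for all $k\ge 1$, all integers $n_1,\ldots,n_k\geq 0$ and all $e_1,\ldots,e_k\in\mathbb{Z}$. *)

theory Defs
  imports "HOL-Probability.Probability" "HOL-Computational_Algebra.Computational_Algebra"
begin

end

theory Submission
  imports Defs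
begin

text \<open>
  The sequence \<open>X n\<close> is a random character of the multiplicative group generated by the
  numbers \<open>g n = n + \<alpha>\<close>, extended one generator at a time by means of independent uniform
  variables. If no positive power of \<open>g N\<close> lies in the subgroup generated by the earlier
  generators, then \<open>X N\<close> is a fresh uniform point of the circle. Otherwise let \<open>m\<close> be the least
  positive exponent with \<open>g N ^ m\<close> in that subgroup; then \<open>X N ^ m\<close> is already prescribed, and
  \<open>X N\<close> is a uniformly random \<open>m\<close>-th root of it. In either case the fresh randomness makes the
  expectation of a monomial vanish unless the exponent of \<open>X N\<close> is a multiple of \<open>m\<close> (of \<open>0\<close> in
  the first case), and then \<open>X N\<close> can be eliminated.
\<close>

section \<open>Character integrals of the uniform law on the unit interval\<close>

definition unif :: "real measure" where
  "unif = density lborel (\<lambda>x. ennreal (indicator {0..1} x))"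

lemma sets_unif [measurable_cong, simp]: "sets unif = sets borel"
  by (simp add: unif_def)

lemma space_unif [simp]: "space unif = UNIV"
  by (simp add: unif_def)

lemma prob_space_unif: "prob_space unif"
proof
  show "emeasure unif (space unif) = 1"
    by (simp add: unif_def emeasure_density ennreal_indicator)
qed

lemma integral_unif:
  fixes f :: "real \<Rightarrow> complex"
  assumes [measurable]: "f \<in> borel_measurable borel"
  shows "integral\<^sup>L unif f = (\<integral>x. indicator {0..1} x *\<^sub>R f x \<partial>lborel)"
  unfolding unif_def by (subst integral_density) auto

text \<open>For \<open>e \<noteq> 0\<close> the integrand has the primitive
  \<open>exp (w * x) / w\<close> with \<open>w\<close> a multiple of \<open>2 * pi * \<i>\<close>,
  and this takes equal values at both endpoints. It serves the generators of infinite order.\<close>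

lemma integral_unif_cis:
  fixes e :: int
  shows "(\<integral>x. cis (e * (2 * pi * x)) \<partial>unif) = (if e = 0 then 1 else 0)"
proof (cases "e = 0")
  case True
  interpret prob_space unif by (rule prob_space_unif)
  show ?thesis using True prob_space by simp
next
  case False
  define w :: complex where "w = \<i> * of_real (e * (2 * pi))"
  have w: "w \<noteq> 0" using False by (simp add: w_def)
  have exp_cis: "cis (e * (2 * pi * x)) = exp (w * of_real x)" for x
    by (simp add: cis_conv_exp w_def mult_ac)
  have "(\<integral>x. indicator {0..1} x *\<^sub>R exp (w * of_real x) \<partial>lborel) =
          exp (w * of_real 1) / w - exp (w * of_real 0) / w"
  proof (rule integral_FTC_atLeastAtMost)
    fix x :: real
    have "((\<lambda>z. exp (w * z) / w) has_field_derivative exp (w * of_real x)) (at (of_real x))"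
      using w by (auto intro!: derivative_eq_intros)
    from has_vector_derivative_real_field[OF this]
    show "((\<lambda>x. exp (w * of_real x) / w) has_vector_derivative exp (w * of_real x)) (at x within {0..1})"
      by (simp add: o_def)
  qed (auto intro!: continuous_intros)
  also have "\<dots> = 0"
    using cis_multiple_2pi[of "of_int e"] exp_cis[of 1] by (simp add: mult_ac)
  finally show ?thesis
    using False by (subst integral_unif) (simp_all add: exp_cis)
qed

text \<open>The floor is constant on each of \<open>m\<close> intervals of length
  \<open>1 / m\<close>, so the integral is the mean of the powers of an \<open>m\<close>-th root of
  unity \<open>z\<close>. If \<open>z \<noteq> 1\<close>, the geometric sum vanishes. It serves the
  generators of finite order.\<close>

lemma integral_unif_cis_floor:
  fixes e :: int and m :: nat
  assumes m: "m > 0"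
  shows "(\<integral>x. cis (e * (2 * pi * \<lfloor>m * x\<rfloor> / m)) \<partial>unif) = (if int m dvd e then 1 else 0)"
proof (cases "int m dvd e")
  case True
  then obtain q where q: "e = int m * q" by blast
  have "cis (e * (2 * pi * \<lfloor>m * x\<rfloor> / m)) = 1" for x :: real
    using m cis_multiple_2pi[of "of_int (q * \<lfloor>m * x\<rfloor>)"] by (simp add: q mult_ac)
  moreover have "measure unif UNIV = 1"
    using prob_space.prob_space[OF prob_space_unif] by simp
  ultimately show ?thesis using True by simp
next
  case False
  define z where "z = cis (2 * pi * e / m)"
  define I where "I k = {real k / m..<real (Suc k) / m}" for k
  have "z \<noteq> 1"
  proof
    assume "z = 1"
    then have "cos (2 * pi * e / m) = 1"
      by (simp add: z_def complex_eq_iff)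
    then obtain n :: int where "2 * pi * e / m = n * 2 * pi"
      by (auto simp: cos_one_2pi_int)
    then have "real_of_int e = real_of_int (int m * n)"
      using m by (simp add: field_simps)
    then have "e = int m * n" by (simp only: of_int_eq_iff)
    then show False using False by simp
  qed
  have zm: "z ^ m = 1"
    using m cis_multiple_2pi[of "of_int e"] by (simp add: z_def Complex.DeMoivre mult_ac)
  have "(\<integral>x. indicator {0..1} x *\<^sub>R cis (e * (2 * pi * \<lfloor>m * x\<rfloor> / m)) \<partial>lborel) =
        (\<integral>x. (\<Sum>k<m. indicator (I k) x *\<^sub>R z ^ k) \<partial>lborel)"
  proof (rule integral_cong_AE)
    show "AE x in lborel. indicator {0..1} x *\<^sub>R cis (e * (2 * pi * \<lfloor>m * x\<rfloor> / m)) =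
            (\<Sum>k<m. indicator (I k) x *\<^sub>R z ^ k)"
    \<comment> \<open>At \<open>x = 1\<close> the floor equals \<open>m\<close>, and none of the
      intervals \<open>I k\<close> with \<open>k < m\<close> contains this point; it is discarded as
      a null set.\<close>
    proof (rule AE_mp[OF AE_lborel_singleton[of 1]], rule AE_I2, rule impI)
      fix x :: real assume "x \<noteq> 1"
      have mem: "x \<in> I k \<longleftrightarrow> \<lfloor>m * x\<rfloor> = int k" for k
        using m by (auto simp: I_def floor_eq_iff field_simps)
      show "indicator {0..1} x *\<^sub>R cis (e * (2 * pi * \<lfloor>m * x\<rfloor> / m)) =
            (\<Sum>k<m. indicator (I k) x *\<^sub>R z ^ k)"
      proof (cases "x \<in> {0..1}")
        case True
        define j where "j = nat \<lfloor>m * x\<rfloor>"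
        have j: "\<lfloor>m * x\<rfloor> = int j" using True by (simp add: j_def)
        have "real m * x < m" using True \<open>x \<noteq> 1\<close> m by simp
        then have "j < m" using j by linarith
        have "(\<Sum>k<m. indicator (I k) x *\<^sub>R z ^ k) = (\<Sum>k<m. if k = j then z ^ k else 0)"
          by (intro sum.cong) (auto simp: mem j indicator_def)
        also have "\<dots> = cis (e * (2 * pi * int j / m))"
          using \<open>j < m\<close> by (simp add: z_def Complex.DeMoivre mult_ac)
        finally show ?thesis
          using True by (simp add: j)
      next
        case False
        have "x \<notin> I k" if "k < m" for k
        proof
          assume "x \<in> I k"
          then have "real k \<le> m * x" "m * x < Suc k"
            using m by (auto simp: I_def field_simps)
          moreover have "real (Suc k) \<le> m" using that by simp
          ultimately have "0 \<le> m * x" "m * x \<le> m * 1" by linarith+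
          then show False using False m by (simp add: zero_le_mult_iff)
        qed
        then show ?thesis using False by simp
      qed
    qed
  qed (unfold I_def, measurable)
  also have "\<dots> = (\<Sum>k<m. \<integral>x. indicator (I k) x *\<^sub>R z ^ k \<partial>lborel)"
    by (rule Bochner_Integration.integral_sum) (auto simp: I_def divide_right_mono)
  also have "\<dots> = (\<Sum>k<m. (1 / m) *\<^sub>R z ^ k)"
    by (intro sum.cong refl) (simp add: I_def divide_right_mono flip: diff_divide_distrib)
  also have "\<dots> = (1 / m) *\<^sub>R (\<Sum>k<m. z ^ k)"
    by (simp add: scaleR_sum_right)
  also have "\<dots> = 0"
    using \<open>z \<noteq> 1\<close> by (simp add: geometric_sum zm)
  finally show ?thesis
    using False by (subst integral_unif) simp_all
qed

section \<open>Order of a generator modulo the earlier ones\<close>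

lemma power_int_prod:
  fixes f :: "'i \<Rightarrow> 'a::field"
  shows "(\<Prod>i\<in>A. f i) powi n = (\<Prod>i\<in>A. f i powi n)"
  by (induction A rule: infinite_finite_induct) (auto simp: power_int_mult_distrib)

text \<open>As \<open>c\<close> ranges over all integer exponents, the products run through the
  subgroup generated by the earlier generators, provided that these are nonzero.\<close>

definition rel_exponents :: "(nat \<Rightarrow> 'a::field) \<Rightarrow> nat \<Rightarrow> nat set" where
  "rel_exponents g N = {m. 0 < m \<and> (\<exists>c. g N ^ m = (\<Prod>i<N. g i powi c i))}"

text \<open>The value \<open>0\<close> encodes that \<open>g N\<close> has infinite order modulo the earlier generators;
  \<open>rel_coeff g N\<close> is then junk.\<close>

definition rel_order :: "(nat \<Rightarrow> 'a::field) \<Rightarrow> nat \<Rightarrow> nat" where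
  "rel_order g N = (if rel_exponents g N = {} then 0 else Inf (rel_exponents g N))"

definition rel_coeff :: "(nat \<Rightarrow> 'a::field) \<Rightarrow> nat \<Rightarrow> nat \<Rightarrow> int" where
  "rel_coeff g N = (SOME c. g N ^ rel_order g N = (\<Prod>i<N. g i powi c i))"

lemma rel_coeff:
  assumes "rel_order g N > 0"
  shows "g N ^ rel_order g N = (\<Prod>i<N. g i powi rel_coeff g N i)"
proof -
  have "rel_order g N \<in> rel_exponents g N"
    using assms Inf_nat_def1[of "rel_exponents g N"] by (auto simp: rel_order_def split: if_splits)
  then have "\<exists>c. g N ^ rel_order g N = (\<Prod>i<N. g i powi c i)"
    by (simp add: rel_exponents_def)
  then show ?thesis unfolding rel_coeff_def by (rule someI_ex)
qed

text \<open>The exponents \<open>e\<close> for which \<open>g N powi e\<close> lies in the earlier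
  subgroup form an ideal of the integers, generated by its least positive element. If there is none,
  the ideal is zero, in accordance with \<open>rel_order g N = 0\<close>.\<close>

lemma rel_order_dvd:
  fixes g :: "nat \<Rightarrow> 'a::field" and e :: int
  assumes nz: "\<And>i. g i \<noteq> 0" and eq: "g N powi e = (\<Prod>i<N. g i powi c i)"
  shows "int (rel_order g N) dvd e"
proof -
  let ?K = "rel_exponents g N"
  show ?thesis
  proof (cases "rel_order g N = 0")
    case True
    have "?K = {}"
      using Inf_nat_def1[of ?K] True by (auto simp: rel_order_def rel_exponents_def split: if_splits)
    have "e = 0"
    proof (rule ccontr)
      assume "e \<noteq> 0"
      \<comment> \<open>For negative \<open>e\<close> the relation is inverted, so that the exponent
        on the left becomes positive.\<close>
      have "g N ^ nat \<bar>e\<bar> = (\<Prod>i<N. g i powi (sgn e * c i))"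
      proof (cases "e > 0")
        case True
        then show ?thesis using eq by (simp add: power_int_def)
      next
        case False
        then have "g N ^ nat \<bar>e\<bar> = inverse (g N powi e)"
          using \<open>e \<noteq> 0\<close> by (simp add: power_int_def power_inverse)
        also have "\<dots> = (\<Prod>i<N. g i powi (sgn e * c i))"
          using False \<open>e \<noteq> 0\<close> unfolding eq
          by (simp add: power_int_minus prod_inversef[symmetric] o_def)
        finally show ?thesis .
      qed
      then have "nat \<bar>e\<bar> \<in> ?K" using \<open>e \<noteq> 0\<close> by (auto simp: rel_exponents_def)
      then show False using \<open>?K = {}\<close> by blast
    qed
    then show ?thesis by simp
  next
    case False
    define m where "m = rel_order g N"
    define r where "r = e mod int m"
    have m: "m > 0" using False by (simp add: m_def)
    have r: "0 \<le> r" "r < int m" using m by (auto simp: r_def)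
    \<comment> \<open>Dividing the given relation by the power \<open>e div int m\<close> of the
      chosen one leaves the exponent \<open>r < m\<close>, and minimality of \<open>m\<close> then
      forces \<open>r = 0\<close>.\<close>
    have "g N powi r = g N powi (e - int m * (e div int m))"
      by (simp add: r_def minus_mult_div_eq_mod)
    also have "\<dots> = g N powi e / (g N ^ m) powi (e div int m)"
      using nz by (simp add: power_int_diff power_int_mult)
    also have "\<dots> = (\<Prod>i<N. g i powi (c i - rel_coeff g N i * (e div int m)))"
      using nz rel_coeff[of g N] m
      by (simp add: eq m_def power_int_prod prod_dividef power_int_diff power_int_mult)
    finally have "g N ^ nat r = (\<Prod>i<N. g i powi (c i - rel_coeff g N i * (e div int m)))"
      using r by (simp add: power_int_def)
    then have "r = 0 \<or> nat r \<in> ?K" using r by (auto simp: rel_exponents_def)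
    moreover have "nat r \<notin> ?K"
    proof
      assume "nat r \<in> ?K"
      moreover from this have "Inf ?K \<le> nat r" by (rule wellorder_Inf_le1)
      ultimately show False using r by (auto simp: m_def rel_order_def split: if_splits)
    qed
    ultimately show ?thesis by (auto simp: r_def m_def)
  qed
qed

section \<open>Construction and measurability of the random angles\<close>

text \<open>The floor of \<open>m * u N\<close>, with \<open>m = rel_order g N\<close>, is uniform on \<open>{0..<m}\<close>
  and selects one of the \<open>m\<close>-th roots.\<close>

fun random_angle :: "(nat \<Rightarrow> 'a::field) \<Rightarrow> (nat \<Rightarrow> real) \<Rightarrow> nat \<Rightarrow> real" where
  "random_angle g u N =
     (if rel_order g N = 0 then 2 * pi * u N
      else ((\<Sum>i<N. rel_coeff g N i * random_angle g u i) + 2 * pi * \<lfloor>real (rel_order g N) * u N\<rfloor>)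
             / rel_order g N)"

declare random_angle.simps [simp del]

text \<open>The recursion only descends, so no later coordinate is read. This is what makes the
  angles below \<open>N\<close> independent of \<open>u N\<close>.\<close>

lemma random_angle_cong:
  assumes "\<And>i. i \<le> N \<Longrightarrow> u i = v i"
  shows "random_angle g u N = random_angle g v N"
  using assms
proof (induction N rule: less_induct)
  case (less N)
  then have "random_angle g u i = random_angle g v i" if "i < N" for i
    using that by simp
  then show ?case using less.prems[of N] by (simp add: random_angle.simps[of g _ N])
qed

lemma borel_measurable_random_angle:
  assumes "\<And>i. i \<le> N \<Longrightarrow> (\<lambda>\<omega>. u \<omega> i) \<in> borel_measurable M"
  shows "(\<lambda>\<omega>. random_angle g (u \<omega>) N) \<in> borel_measurable M"
  using assms
proof (induction N rule: less_induct)
  case (less N)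
  note [measurable] = less.prems[OF order.refl]
  have [measurable]: "(\<lambda>\<omega>. random_angle g (u \<omega>) i) \<in> borel_measurable M" if "i \<in> {..<N}" for i
    using that by (intro less.IH less.prems) auto
  show ?case by (subst random_angle.simps) measurable
qed

lemma measurable_cis [measurable]: "cis \<in> borel_measurable borel"
  by (intro borel_measurable_continuous_onI continuous_intros)

section \<open>Expectations of monomials\<close>

context prob_space
begin

text \<open>The first factor is a function of the coordinates below \<open>N\<close> and the second
  of \<open>u N\<close> alone, so independence splits the expectation. The coefficients
  \<open>a i\<close> are real because eliminating a generator of order \<open>m\<close> produces
  fractions with denominator \<open>m\<close>.\<close>

lemma expectation_random_angle_mult:
  assumes indep: "indep_vars (\<lambda>_. borel) u UNIV" and law: "\<And>n. distr M borel (u n) = unif"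
    and h: "h \<in> borel_measurable borel"
  shows "expectation (\<lambda>\<omega>. cis (\<Sum>i<N. a i * random_angle g (\<lambda>i. u i \<omega>) i) * cis (h (u N \<omega>))) =
         expectation (\<lambda>\<omega>. cis (\<Sum>i<N. a i * random_angle g (\<lambda>i. u i \<omega>) i)) *
           (\<integral>x. cis (h x) \<partial>unif)"
proof -
  define F where "F = (\<lambda>x :: nat \<Rightarrow> real. cis (\<Sum>i<N. a i * random_angle g x i))"
  define G where "G = (\<lambda>x :: nat \<Rightarrow> real. cis (h (x N)))"
  have u: "u n \<in> borel_measurable M" for n
    using indep by (simp add: indep_vars_def)
  have "(\<lambda>x. random_angle g x i) \<in> borel_measurable (PiM {..<N} (\<lambda>_. borel))" if "i \<in> {..<N}" for i
    using that by (intro borel_measurable_random_angle measurable_component_singleton) auto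
  then have F_meas: "F \<in> borel_measurable (PiM {..<N} (\<lambda>_. borel))"
    unfolding F_def
    by (intro measurable_compose[OF _ measurable_cis] borel_measurable_sum borel_measurable_times
          borel_measurable_const)
  have G_meas: "G \<in> borel_measurable (PiM {N} (\<lambda>_. borel))"
    unfolding G_def
    by (intro measurable_compose[OF _ measurable_cis] measurable_compose[OF _ h]
          measurable_component_singleton) simp
  \<comment> \<open>Restriction alters only coordinates from \<open>N\<close> on, which the angles
    below \<open>N\<close> do not see.\<close>
  have F: "F (restrict (\<lambda>i. u i \<omega>) {..<N}) = cis (\<Sum>i<N. a i * random_angle g (\<lambda>i. u i \<omega>) i)" for \<omega>
    unfolding F_def
    by (intro arg_cong[of _ _ cis] sum.cong refl arg_cong2[of _ _ _ _ "(*)"] random_angle_cong) auto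
  have G: "G (restrict (\<lambda>i. u i \<omega>) {N}) = cis (h (u N \<omega>))" for \<omega>
    by (simp add: G_def)
  have "indep_var borel (F \<circ> (\<lambda>\<omega>. restrict (\<lambda>i. u i \<omega>) {..<N}))
                  borel (G \<circ> (\<lambda>\<omega>. restrict (\<lambda>i. u i \<omega>) {N}))"
    by (rule indep_var_compose[OF indep_var_restrict[OF indep] F_meas G_meas]) auto
  then have iv: "indep_var borel (\<lambda>\<omega>. cis (\<Sum>i<N. a i * random_angle g (\<lambda>i. u i \<omega>) i))
                  borel (\<lambda>\<omega>. cis (h (u N \<omega>)))"
    by (simp add: o_def F G)
  have int: "integrable M (\<lambda>\<omega>. cis (f \<omega>))" if "(\<lambda>\<omega>. cis (f \<omega>)) \<in> borel_measurable M" for f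
    using that by (intro integrable_const_bound[where B = 1] AE_I2) simp_all
  have "(\<integral>x. cis (h x) \<partial>unif) = (\<integral>x. cis (h x) \<partial>distr M borel (u N))"
    by (simp only: law)
  also have "\<dots> = expectation (\<lambda>\<omega>. cis (h (u N \<omega>)))"
    by (rule integral_distr[OF u measurable_compose[OF h measurable_cis]])
  finally show ?thesis
    using indep_var_lebesgue_integral[OF iv int[OF indep_var_rv1[OF iv]] int[OF indep_var_rv2[OF iv]]]
    by (simp only:)
qed

text \<open>Induction on the number of generators: the randomness of the last one contributes a
  factor \<open>1\<close> or \<open>0\<close>, and in the former case its power is absorbed into the
  exponents of the others. Hence \<open>e\<close> has to vary in the induction.\<close>

lemma expectation_random_angle:
  fixes g :: "nat \<Rightarrow> 'b::field" and e :: "nat \<Rightarrow> int"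
  assumes indep: "indep_vars (\<lambda>_. borel) u UNIV" and law: "\<And>n. distr M borel (u n) = unif"
    and nz: "\<And>n. g n \<noteq> 0"
  shows "expectation (\<lambda>\<omega>. cis (\<Sum>i<N. e i * random_angle g (\<lambda>i. u i \<omega>) i)) =
         (if (\<Prod>i<N. g i powi e i) = 1 then 1 else 0)"
proof (induction N arbitrary: e)
  case 0
  then show ?case by (simp add: prob_space)
next
  case (Suc N)
  define m where "m = rel_order g N"
  let ?\<theta> = "\<lambda>\<omega>. random_angle g (\<lambda>i. u i \<omega>)"
  \<comment> \<open>A trivial monomial expresses \<open>g N powi e N\<close> through the earlier
    generators. For \<open>m = 0\<close> the conclusion reads \<open>e N = 0\<close>.\<close>
  have dvd: "int m dvd e N" if "(\<Prod>i<Suc N. g i powi e i) = 1"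
  proof -
    have "(\<Prod>i<N. g i powi e i) * g N powi e N = 1"
      using that by simp
    then have "g N powi e N = inverse (\<Prod>i<N. g i powi e i)"
      by (simp add: inverse_unique)
    also have "\<dots> = (\<Prod>i<N. g i powi (- e i))"
      by (simp add: power_int_minus prod_inversef[symmetric] o_def)
    finally show ?thesis unfolding m_def by (rule rel_order_dvd[OF nz])
  qed
  show ?case
  proof (cases "m = 0")
    case True
    have "cis (\<Sum>i<Suc N. e i * ?\<theta> \<omega> i) =
            cis (\<Sum>i<N. e i * ?\<theta> \<omega> i) * cis (e N * (2 * pi * u N \<omega>))" for \<omega>
      using True by (simp add: random_angle.simps[of g _ N] m_def cis_mult)
    then have "expectation (\<lambda>\<omega>. cis (\<Sum>i<Suc N. e i * ?\<theta> \<omega> i)) =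
        expectation (\<lambda>\<omega>. cis (\<Sum>i<N. e i * ?\<theta> \<omega> i)) * (\<integral>x. cis (e N * (2 * pi * x)) \<partial>unif)"
      using expectation_random_angle_mult[OF indep law, where N = N and g = g and a = "\<lambda>i. of_int (e i)"
          and h = "\<lambda>x. of_int (e N) * (2 * pi * x)"]
      by simp
    also have "\<dots> = (if (\<Prod>i<Suc N. g i powi e i) = 1 then 1 else 0)"
      using dvd True by (auto simp: integral_unif_cis Suc.IH)
    finally show ?thesis .
  next
    case False
    then have m: "m > 0" by simp
    \<comment> \<open>The angle at \<open>N\<close> contains the \<open>m\<close>-th part of the
      prescribed combination of earlier angles; multiplied by \<open>e N\<close>, it adds these
      fractions to the exponents.\<close>
    define a where "a i = e i + e N * rel_coeff g N i / m" for i
    have "cis (\<Sum>i<Suc N. e i * ?\<theta> \<omega> i) =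
            cis (\<Sum>i<N. a i * ?\<theta> \<omega> i) * cis (e N * (2 * pi * \<lfloor>m * u N \<omega>\<rfloor> / m))" for \<omega>
    proof -
      have "(\<Sum>i<N. a i * ?\<theta> \<omega> i) =
            (\<Sum>i<N. e i * ?\<theta> \<omega> i) + e N * (\<Sum>i<N. rel_coeff g N i * ?\<theta> \<omega> i) / m"
        by (simp add: a_def algebra_simps sum.distrib sum_distrib_left sum_divide_distrib)
      then show ?thesis
        using False
        by (simp add: random_angle.simps[of g _ N] cis_mult add_divide_distrib distrib_left add_ac flip: m_def)
    qed
    then have "expectation (\<lambda>\<omega>. cis (\<Sum>i<Suc N. e i * ?\<theta> \<omega> i)) =
        expectation (\<lambda>\<omega>. cis (\<Sum>i<N. a i * ?\<theta> \<omega> i)) *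
          (\<integral>x. cis (e N * (2 * pi * \<lfloor>m * x\<rfloor> / m)) \<partial>unif)"
      using expectation_random_angle_mult[OF indep law, where N = N and g = g and a = a
          and h = "\<lambda>x. of_int (e N) * (2 * pi * \<lfloor>m * x\<rfloor> / m)"]
      by simp
    also have "\<dots> = expectation (\<lambda>\<omega>. cis (\<Sum>i<N. a i * ?\<theta> \<omega> i)) *
                       (if int m dvd e N then 1 else 0)"
      by (simp only: integral_unif_cis_floor[OF m])
    also have "\<dots> = (if (\<Prod>i<Suc N. g i powi e i) = 1 then 1 else 0)"
    proof (cases "int m dvd e N")
      case True
      then obtain q where q: "e N = int m * q" by blast
      \<comment> \<open>Divisibility makes the coefficients integers again, so the induction
        hypothesis applies. Reading the chosen relation backwards then restores
        \<open>g N powi e N\<close> in the product.\<close>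
      have "a = (\<lambda>i. of_int (e i + q * rel_coeff g N i))"
        using m by (auto simp: a_def q)
      then have "expectation (\<lambda>\<omega>. cis (\<Sum>i<N. a i * ?\<theta> \<omega> i)) =
                   (if (\<Prod>i<N. g i powi (e i + q * rel_coeff g N i)) = 1 then 1 else 0)"
        by (simp only: Suc.IH)
      also have "(\<Prod>i<N. g i powi (e i + q * rel_coeff g N i)) =
                   (\<Prod>i<N. g i powi e i) * (g N ^ m) powi q"
        using rel_coeff[of g N] m nz
        by (simp add: m_def power_int_add prod.distrib power_int_prod mult.commute[of q]
              power_int_mult)
      also have "\<dots> = (\<Prod>i<Suc N. g i powi e i)"
        by (simp add: q power_int_mult)
      finally show ?thesis using True by simp
    qed (use dvd in auto)
    finally show ?thesis .
  qed
qed

text \<open>Indices \<open>n i\<close> may repeat. Adding up the exponents that belong to the same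
  generator gives a monomial over an initial segment, with exponents \<open>d\<close>.\<close>

lemma expectation_random_angle_prod:
  fixes g :: "nat \<Rightarrow> 'b::field" and e :: "'i \<Rightarrow> int" and n :: "'i \<Rightarrow> nat"
  assumes indep: "indep_vars (\<lambda>_. borel) u UNIV" and law: "\<And>n. distr M borel (u n) = unif"
    and nz: "\<And>n. g n \<noteq> 0" and I: "finite I"
  shows "expectation (\<lambda>\<omega>. \<Prod>i\<in>I. cis (random_angle g (\<lambda>i. u i \<omega>) (n i)) powi e i) =
         (if (\<Prod>i\<in>I. g (n i) powi e i) = 1 then 1 else 0)"
proof -
  obtain N where N: "n ` I \<subseteq> {..<N}"
    using I finite_nat_bounded by blast
  define d where "d j = (\<Sum>i | i \<in> I \<and> n i = j. e i)" for j
  have cis_sum: "(\<Prod>i\<in>J. cis (f i)) = cis (\<Sum>i\<in>J. f i)" for f and J :: "'i set"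
    by (induction J rule: infinite_finite_induct) (auto simp: cis_mult)
  have "(\<Prod>i\<in>I. cis (t (n i)) powi e i) = cis (\<Sum>j<N. d j * t j)" for t :: "nat \<Rightarrow> real"
  proof -
    have "(\<Sum>j<N. d j * t j) = (\<Sum>j<N. \<Sum>i | i \<in> I \<and> n i = j. e i * t (n i))"
      by (simp add: d_def sum_distrib_right)
    also have "\<dots> = (\<Sum>i\<in>I. e i * t (n i))"
      by (rule sum.group[OF I _ N]) simp
    finally show ?thesis by (simp add: cis_power_int cis_sum)
  qed
  moreover have "(\<Prod>i\<in>I. g (n i) powi e i) = (\<Prod>j<N. g j powi d j)"
  proof -
    have *: "x powi (\<Sum>i\<in>J. e i) = (\<Prod>i\<in>J. x powi e i)" if "x \<noteq> 0" for x :: 'b and J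
      using that by (induction J rule: infinite_finite_induct) (auto simp: power_int_add)
    have "(\<Prod>j<N. g j powi d j) = (\<Prod>j<N. \<Prod>i | i \<in> I \<and> n i = j. g (n i) powi e i)"
      by (simp add: d_def * nz)
    also have "\<dots> = (\<Prod>i\<in>I. g (n i) powi e i)"
      by (rule prod.group[OF I _ N]) simp
    finally show ?thesis ..
  qed
  ultimately show ?thesis
    using expectation_random_angle[OF indep law nz, where N = N and e = d] by simp
qed

end

section \<open>Realisation on a product space\<close>

text \<open>Independence means that the joint law is the product of the marginals; for the
  coordinates, the joint law is the product measure itself.\<close>

lemma indep_vars_PiM_components:
  assumes "\<And>i. i \<in> I \<Longrightarrow> prob_space (M i)" and "I \<noteq> {}"
  shows "prob_space.indep_vars (PiM I M) M (\<lambda>i \<omega>. \<omega> i) I"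
proof -
  interpret prob_space "PiM I M" by (rule prob_space_PiM) fact
  have "distr (PiM I M) (PiM I M) (\<lambda>\<omega>. \<lambda>i\<in>I. \<omega> i) = distr (PiM I M) (PiM I M) (\<lambda>\<omega>. \<omega>)"
    by (intro distr_cong) (auto simp: space_PiM PiE_def extensional_restrict)
  also have "\<dots> = (PiM I (\<lambda>i. distr (PiM I M) (M i) (\<lambda>\<omega>. \<omega> i)))"
    using assms by (simp add: distr_id distr_PiM_component cong: PiM_cong)
  finally show ?thesis
    using assms by (subst indep_vars_iff_distr_eq_PiM') auto
qed

theorem theorem1p1:
  fixes \<alpha> :: real
  assumes "algebraic \<alpha>" and "0 < \<alpha>" and "\<alpha> \<le> 1"
  shows "\<exists>(M :: (nat \<Rightarrow> complex) measure) (X :: nat \<Rightarrow> (nat \<Rightarrow> complex) \<Rightarrow> complex).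
           prob_space M \<and>
           (\<forall>n. prob_space.random_variable M borel (X n)) \<and>
           (\<forall>n. \<forall>\<omega>\<in>space M. X n \<omega> \<in> {z. cmod z = 1}) \<and>
           (\<forall>k\<ge>1. \<forall>(n :: nat \<Rightarrow> nat) (e :: nat \<Rightarrow> int).
              prob_space.expectation M (\<lambda>\<omega>. \<Prod>i=1..k. X (n i) \<omega> powi e i) =
                (if (\<Prod>i=1..k. (real (n i) + \<alpha>) powi e i) = 1 then 1 else 0))"
proof -
  \<comment> \<open>The sample space consists of complex sequences, so the uniform law is carried to
    the real axis in the complex plane and recovered by \<open>Re\<close>.\<close>
  define V :: "complex measure" where "V = distr unif borel complex_of_real"
  define M :: "(nat \<Rightarrow> complex) measure" where "M = PiM UNIV (\<lambda>_. V)"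
  define u :: "nat \<Rightarrow> (nat \<Rightarrow> complex) \<Rightarrow> real" where "u n \<omega> = Re (\<omega> n)" for n \<omega>
  define g where "g n = real n + \<alpha>" for n
  define X where "X n \<omega> = cis (random_angle g (\<lambda>i. u i \<omega>) n)" for n \<omega>
  have V: "prob_space V"
    unfolding V_def by (intro prob_space.prob_space_distr prob_space_unif) measurable
  have [measurable_cong]: "sets V = sets borel" by (simp add: V_def)
  interpret prob_space M
    unfolding M_def by (rule prob_space_PiM) (rule V)
  have u: "u n \<in> borel_measurable M" for n
    unfolding u_def M_def by measurable
  have "indep_vars (\<lambda>_. V) (\<lambda>i \<omega>. \<omega> i) UNIV"
    unfolding M_def by (rule indep_vars_PiM_components) (auto intro: V)
  from indep_vars_compose2[OF this, of "\<lambda>_. Re" "\<lambda>_. borel"]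
  have indep: "indep_vars (\<lambda>_. borel) u UNIV"
    by (simp add: u_def [abs_def])
  have law: "distr M borel (u n) = unif" for n
  proof -
    have "distr M borel (u n) = distr (distr M V (\<lambda>\<omega>. \<omega> n)) borel Re"
      unfolding u_def M_def by (subst distr_distr) (auto simp: o_def)
    also have "distr M V (\<lambda>\<omega>. \<omega> n) = V"
      unfolding M_def by (rule distr_PiM_component) (auto intro: V)
    also have "distr V borel Re = unif"
      unfolding V_def by (subst distr_distr) (auto simp: o_def intro: distr_id2)
    finally show ?thesis .
  qed
  \<comment> \<open>Positivity of \<open>\<alpha>\<close> matters at \<open>n = 0\<close>, where
    \<open>g 0 = \<alpha>\<close>.\<close>
  have "g n \<noteq> 0" for n
    using \<open>0 < \<alpha>\<close> by (simp add: g_def add_nonneg_eq_0_iff)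
  then have "expectation (\<lambda>\<omega>. \<Prod>i=1..k. X (n i) \<omega> powi e i) =
      (if (\<Prod>i=1..k. (real (n i) + \<alpha>) powi e i) = 1 then 1 else 0)" for k :: nat and n e
    using expectation_random_angle_prod[OF indep law, of g "{1..k}" n e] by (simp add: X_def g_def)
  moreover have "X n \<in> borel_measurable M" for n
  proof -
    have [measurable]: "(\<lambda>\<omega>. random_angle g (\<lambda>i. u i \<omega>) n) \<in> borel_measurable M"
      by (rule borel_measurable_random_angle) (rule u)
    show ?thesis unfolding X_def [abs_def] by measurable
  qed
  moreover have "cmod (X n \<omega>) = 1" for n \<omega>
    by (simp add: X_def)
  ultimately show ?thesis
    by (intro exI[of _ M] exI[of _ X]) (auto intro: prob_space_axioms)
qed

end
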